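(* For all sufficiently large integers $n$, we have $\displaystyle c_\infty(Q_n) \ge \frac{2^{n-3}}{n \ln n}$, where $Q_n$ is the $n$-dimensional hypercube.
   Context: The infinite-speed game of Cops and Robbers on a finite graph $G$: there is a team of cops and one robber, each occupying a vertex of $G$ (several cops may share a vertex), with all positions known to both players. The cops first choose their initial positions; then the robber chooses his initial position. The game proceeds in rounds, each consisting of a cop turn followed by a robber turn. On the cops' turn, each cop either stays at her vertex or moves to a neighboring vertex. On the robber's turn, he may stay put or move along any path in $G$ of arbitrary length starting at his current vertex that does not pass through any vertex occupied by a cop. The cops win if at some point some cop occupies the same vertex as the robber; the robber wins if he evades capture forever. The infinite-speed cop number $c_\infty(G)$ is the minimum number of cops that guarantees a win for the cops on $G$ no matter how the robber plays. The hypercube $Q_n$ has as vertices all $n$-bit binary strings, two being adjacent if and only if they differ in exactly one bit. *)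

theory Defs
  imports Complex_Main "Graph_Theory.Graph_Theory"
begin

text \<open>
  Finite simple graphs are \<^term>\<open>pair_graph\<close>s: loop-free symmetric digraphs, each undirected
  edge being represented by its two orientations.

  A strategy for \<open>k\<close> cops maps the list of robber positions so far (oldest first) to the positions
  of the cops \<open>i < k\<close>: \<open>s []\<close> is the initial placement, and \<open>s [r\<^sub>0, \<dots>, r\<^sub>t]\<close> is the placement
  after the cop turn in which the robber stands on \<open>r\<^sub>t\<close>. Since the earlier cop positions are
  determined by the strategy and the earlier robber positions, this is full information.
  Legality is required for all lists; on lists that cannot arise in a play the cops can stay put.
\<close>

type_synonym 'a cop_strategy = "'a list \<Rightarrow> nat \<Rightarrow> 'a"

definition legal_cop_strategy :: "'a pair_pre_digraph \<Rightarrow> nat \<Rightarrow> 'a cop_strategy \<Rightarrow> bool" where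
  "legal_cop_strategy G k s \<longleftrightarrow>
     (\<forall>i<k. s [] i \<in> pverts G) \<and>
     (\<forall>h r. \<forall>i<k. s (h @ [r]) i = s h i \<or> (s h i, s (h @ [r]) i) \<in> parcs G)"

definition robber_move :: "'a pair_pre_digraph \<Rightarrow> 'a set \<Rightarrow> 'a \<Rightarrow> 'a \<Rightarrow> bool" where
  "robber_move G C u v \<longleftrightarrow>
     u = v \<or> (\<exists>p. vpath p (with_proj G) \<and> hd p = u \<and> last p = v \<and> set p \<inter> C = {})"

text \<open>
  Placement \<open>0\<close> is the initial one, placement \<open>Suc t\<close> is the one after the cop turn of round \<open>t\<close>.
  A robber play \<open>r\<close> lists his initial position \<open>r 0\<close> and his position \<open>r (Suc t)\<close> at the end of
  round \<open>t\<close>.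
\<close>

definition cops_at :: "nat \<Rightarrow> 'a cop_strategy \<Rightarrow> (nat \<Rightarrow> 'a) \<Rightarrow> nat \<Rightarrow> 'a set" where
  "cops_at k s r t = s (map r [0..<t]) ` {..<k}"

definition legal_robber_play ::
  "'a pair_pre_digraph \<Rightarrow> nat \<Rightarrow> 'a cop_strategy \<Rightarrow> (nat \<Rightarrow> 'a) \<Rightarrow> bool" where
  "legal_robber_play G k s r \<longleftrightarrow>
     r 0 \<in> pverts G \<and> (\<forall>t. robber_move G (cops_at k s r (Suc t)) (r t) (r (Suc t)))"

text \<open>
  Capture is tested after every robber placement or move (first disjunct) and after every cop turn
  (second disjunct). A play that ends with a capture is still represented by infinite sequences \<open>r\<close>; one always
  exists, because staying put is legal for the robber, and what happens after the capture is
  irrelevant.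
\<close>

definition captured :: "nat \<Rightarrow> 'a cop_strategy \<Rightarrow> (nat \<Rightarrow> 'a) \<Rightarrow> bool" where
  "captured k s r \<longleftrightarrow> (\<exists>t. r t \<in> cops_at k s r t \<or> r t \<in> cops_at k s r (Suc t))"

definition cops_win :: "'a pair_pre_digraph \<Rightarrow> nat \<Rightarrow> bool" where
  "cops_win G k \<longleftrightarrow>
     (\<exists>s. legal_cop_strategy G k s \<and> (\<forall>r. legal_robber_play G k s r \<longrightarrow> captured k s r))"

definition cop_number_inf :: "'a pair_pre_digraph \<Rightarrow> nat" where
  "cop_number_inf G = (LEAST k. cops_win G k)"

text \<open>The minimum is attained: on a finite graph, one cop per vertex wins.\<close>

lemma cops_win_card:
  assumes "finite (pverts G)"
  shows "cops_win G (card (pverts G))"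
proof -
  obtain f where f: "bij_betw f {..<card (pverts G)} (pverts G)"
    using ex_bij_betw_nat_finite[OF assms] by (auto simp: atLeast0LessThan)
  then have im: "f ` {..<card (pverts G)} = pverts G"
    by (simp add: bij_betw_def)
  show ?thesis
    unfolding cops_win_def legal_cop_strategy_def legal_robber_play_def captured_def cops_at_def
    by (rule exI[of _ "\<lambda>_. f"]) (use im in auto)
qed

lemma cops_win_cop_number_inf:
  "finite (pverts G) \<Longrightarrow> cops_win G (cop_number_inf G)"
  unfolding cop_number_inf_def by (rule LeastI) (rule cops_win_card)

definition hypercube :: "nat \<Rightarrow> bool list pair_pre_digraph" where
  "hypercube n =
     \<lparr> pverts = {x. length x = n},
       parcs = {(x, y). length x = n \<and> length y = n \<and> (\<exists>!i. i < n \<and> x ! i \<noteq> y ! i)} \<rparr>"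

lemma finite_hypercube_verts: "finite (pverts (hypercube n))"
  using finite_lists_length_eq[of "UNIV :: bool set" n] by (simp add: hypercube_def)

lemma pair_graph_hypercube: "pair_graph (hypercube n)"
proof -
  have "parcs (hypercube n) \<subseteq> pverts (hypercube n) \<times> pverts (hypercube n)"
    by (auto simp: hypercube_def)
  then have "finite (parcs (hypercube n))"
    using finite_hypercube_verts finite_subset by blast
  moreover have "symmetric (with_proj (hypercube n))"
  proof -
    have "(y, x) \<in> parcs (hypercube n)" if "(x, y) \<in> parcs (hypercube n)" for x y
    proof -
      have "(x ! i \<noteq> y ! i) = (y ! i \<noteq> x ! i)" for i by blast
      then show ?thesis using that unfolding hypercube_def by simp
    qed
    then show ?thesis unfolding symmetric_def sym_def by simp
  qed
  ultimately show ?thesis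
    by unfold_locales (auto simp: finite_hypercube_verts, auto simp: hypercube_def)
qed

end

theory Submission
  imports Defs "HOL-Analysis.Harmonic_Numbers" "HOL-Real_Asymp.Real_Asymp"
begin

text \<open>
  Write \<open>d\<close> for the Hamming distance and suppose that there are \<open>k\<close> cops on \<open>Q\<^sub>n\<close>, with
  \<open>8 k n ln n < 2\<^sup>n\<close>. The robber survives by standing, before every cop turn, on a vertex \<open>v\<close>
  that is safe in the following sense: wherever the cops go in one step, the random geodesic from
  \<open>v\<close> to its antipode (flip the coordinates in random order) meets a cop with probability less than
  \<open>1/2\<close>. This geodesic visits a given vertex \<open>x\<close> with probability \<open>1 / (n choose d v x)\<close>, so it is
  enough that the sum over all cops of the largest such value over the closed neighbourhood of the
  cop is below \<open>1/2\<close>. That largest value is bounded by \<open>threat\<close>, and the sum is \<open>exposure\<close>.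

  Two facts make this strategy work.

  First, from a safe vertex the robber can reach more than half of the cube after any cop turn. In
  every layer around \<open>v\<close> more than half of the vertices are reachable along geodesics that avoid the
  cops. No probability space is needed for this: passing from one layer to the next, the density of
  the reachable set does not drop before the cops of the new layer are removed (local LYM
  inequality, \<open>density_up_shadow\<close>), and each cop at distance \<open>i\<close> costs density
  \<open>1 / (n choose i)\<close> (\<open>density_climb\<close>). The outcome is \<open>card_reach\<close>.

  Secondly, more than half of the vertices are safe for any position of the cops. There are
  \<open>n choose j\<close> vertices at distance \<open>j\<close> from a cop, and for \<open>0 < j \<le> n / 2\<close> each of them is
  threatened by \<open>1 / (n choose (j - 1))\<close>, which amounts to \<open>(n + 1) / j - 1\<close> in total. The far half
  of the cube contributes as much, so the harmonic sum bounds the total threat of one cop by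
  \<open>2 n ln n\<close> for large \<open>n\<close> (\<open>eventually_sum_threat_le\<close>). By Markov's inequality at most
  \<open>4 k n ln n < 2\<^sup>n / 2\<close> vertices are unsafe (\<open>card_safe\<close>).

  Two sets that each contain more than half of the cube intersect, so the robber can always move
  from a vertex that was safe before the cop turn to one that is safe after it (\<open>escape\<close>).
\<close>

section \<open>Climbing through the layers of the Boolean lattice\<close>

definition up_shadow :: "nat \<Rightarrow> nat set set \<Rightarrow> nat set set" where
  "up_shadow n F = {insert i S | i S. S \<in> F \<and> i < n \<and> i \<notin> S}"

lemma up_shadow_layer:
  assumes "F \<subseteq> {S. S \<subseteq> {..<n} \<and> card S = j}"
  shows "up_shadow n F \<subseteq> {S. S \<subseteq> {..<n} \<and> card S = Suc j}"
proof
  fix T assume "T \<in> up_shadow n F"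
  then obtain i S where T: "T = insert i S" "S \<in> F" "i < n" "i \<notin> S"
    by (auto simp: up_shadow_def)
  with assms have "S \<subseteq> {..<n}" "card S = j" by auto
  moreover from this have "finite S" using finite_subset by blast
  ultimately show "T \<in> {S. S \<subseteq> {..<n} \<and> card S = Suc j}"
    using T by auto
qed

lemma finite_layer: "finite {S. S \<subseteq> {..<n::nat} \<and> card S = j}"
  by (rule finite_subset[of _ "Pow {..<n}"]) auto

text \<open>
  Count the pairs \<open>(S, insert i S)\<close>: every \<open>S\<close> in \<open>F\<close> has \<open>n - j\<close> upper neighbours, and every set
  of size \<open>j + 1\<close> has only \<open>j + 1\<close> lower neighbours.
\<close>

lemma card_up_shadow:
  assumes F: "F \<subseteq> {S. S \<subseteq> {..<n} \<and> card S = j}"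
  shows "card F * (n - j) \<le> card (up_shadow n F) * Suc j"
proof -
  note U = up_shadow_layer[OF F]
  have fin: "finite F" "finite (up_shadow n F)"
    using finite_subset[OF F finite_layer] finite_subset[OF U finite_layer] by auto
  have finS: "finite S" if "S \<subseteq> {..<n}" for S
    using that finite_subset by blast
  let ?A = "Sigma F (\<lambda>S. {..<n} - S)" and ?B = "Sigma (up_shadow n F) (\<lambda>T. T)"
  have "card ?A = (\<Sum>S\<in>F. n - j)"
  proof -
    have "card ({..<n} - S) = n - j" if "S \<in> F" for S
      using that F finS by (subst card_Diff_subset) auto
    moreover have "card ?A = (\<Sum>S\<in>F. card ({..<n} - S))"
      using fin(1) by (intro card_SigmaI) auto
    ultimately show ?thesis by simp
  qed
  moreover have "card ?B = (\<Sum>T\<in>up_shadow n F. Suc j)"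
  proof -
    have "card T = Suc j" if "T \<in> up_shadow n F" for T
      using that U by auto
    moreover have "card ?B = (\<Sum>T\<in>up_shadow n F. card T)"
      using fin(2) U finS by (intro card_SigmaI) auto
    ultimately show ?thesis by simp
  qed
  moreover have "card ?A \<le> card ?B"
  proof (rule card_inj_on_le)
    show "inj_on (\<lambda>(S, i). (insert i S, i)) ?A"
      by (auto simp: inj_on_def dest: insert_ident[THEN iffD1, rotated 2])
    show "(\<lambda>(S, i). (insert i S, i)) ` ?A \<subseteq> ?B"
      by (auto simp: up_shadow_def)
    show "finite ?B" using fin(2) U finS by auto
  qed
  ultimately show ?thesis by simp
qed

text \<open>
  The local LYM inequality. It restates the previous count, because
  \<open>(j + 1) (n choose (j + 1)) = (n - j) (n choose j)\<close>.
\<close>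

lemma density_up_shadow:
  assumes F: "F \<subseteq> {S. S \<subseteq> {..<n} \<and> card S = j}" and "j < n"
  shows "real (card F) / (n choose j) \<le> real (card (up_shadow n F)) / (n choose Suc j)"
proof -
  have pos: "real (n choose j) > 0" "real (n choose Suc j) > 0" "real (n - j) > 0"
    using \<open>j < n\<close> by (auto simp: zero_less_binomial_iff)
  have "(n choose Suc j) * Suc j = (n choose j) * (n - j)"
    by (metis binomial_absorb_comp binomial_absorption mult.commute)
  then have c: "real (n choose Suc j) * real (Suc j) = real (n choose j) * real (n - j)"
    by (metis of_nat_mult)
  have "real (card F) * real (n - j) \<le> real (card (up_shadow n F)) * real (Suc j)"
    using card_up_shadow[OF F] by (metis of_nat_le_iff of_nat_mult)
  then have "real (card F) * real (n - j) * (n choose Suc j)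
      \<le> real (card (up_shadow n F)) * real (Suc j) * (n choose Suc j)"
    by (intro mult_right_mono) auto
  also have "\<dots> = real (card (up_shadow n F)) * (n choose j) * real (n - j)"
    using c by (simp add: mult_ac)
  finally have "real (card F) * (n choose Suc j) * real (n - j)
      \<le> real (card (up_shadow n F)) * (n choose j) * real (n - j)"
    by (simp add: mult_ac)
  then have "real (card F) * (n choose Suc j) \<le> real (card (up_shadow n F)) * (n choose j)"
    using pos(3) by simp
  then show ?thesis using pos(1,2) by (simp add: field_simps)
qed

text \<open>
  Models the geodesics that start at a given vertex and avoid a set \<open>X\<close> of obstacles: a vertex is
  encoded as the set of coordinates that have been flipped so far.
\<close>

primrec climb :: "nat \<Rightarrow> nat set set \<Rightarrow> nat \<Rightarrow> nat set set" where
  "climb n X 0 = {{}} - X"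
| "climb n X (Suc j) = up_shadow n (climb n X j) - X"

lemma climb_layer: "climb n X j \<subseteq> {S. S \<subseteq> {..<n} \<and> card S = j}"
proof (induction j)
  case (Suc j)
  from up_shadow_layer[OF this] show ?case by auto
qed auto

text \<open>
  By the local LYM inequality only the removal of obstacles can lower the density from one layer
  to the next. An obstacle of size \<open>i\<close> lowers it by at most \<open>1 / (n choose i)\<close>, once.
\<close>

lemma density_climb:
  assumes "finite X" "j \<le> n"
  shows "1 - (\<Sum>x\<in>{x \<in> X. card x \<le> j}. 1 / real (n choose card x))
    \<le> real (card (climb n X j)) / (n choose j)"
  using \<open>j \<le> n\<close>
proof (induction j)
  case 0
  show ?case
  proof (cases "{} \<in> X")
    case True
    have "1 / real (n choose card ({} :: nat set)) \<le> (\<Sum>x\<in>{x \<in> X. card x \<le> 0}. 1 / real (n choose card x))"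
      using True \<open>finite X\<close>
      by (intro member_le_sum[where f = "\<lambda>x::nat set. 1 / real (n choose card x)"]) auto
    then show ?thesis by simp
  next
    case False
    have "0 \<le> (\<Sum>x\<in>{x \<in> X. card x \<le> 0}. 1 / real (n choose card x))"
      by (intro sum_nonneg) simp
    moreover have "climb n X 0 = {{}}" using False by auto
    ultimately show ?thesis by simp
  qed
next
  case (Suc j)
  let ?L = "{x \<in> X. card x = Suc j}"
  have split: "{x \<in> X. card x \<le> Suc j} = {x \<in> X. card x \<le> j} \<union> ?L" by auto
  have s: "(\<Sum>x\<in>{x \<in> X. card x \<le> Suc j}. 1 / real (n choose card x))
    = (\<Sum>x\<in>{x \<in> X. card x \<le> j}. 1 / real (n choose card x)) + real (card ?L) / (n choose Suc j)"
    unfolding split using \<open>finite X\<close> by (subst sum.union_disjoint) auto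
  let ?U = "up_shadow n (climb n X j)"
  have U: "?U \<subseteq> {S. S \<subseteq> {..<n} \<and> card S = Suc j}"
    by (rule up_shadow_layer[OF climb_layer])
  have "card ?U \<le> card ((?U - X) \<union> ?L)"
    using U \<open>finite X\<close> finite_subset[OF U finite_layer] by (intro card_mono) auto
  also have "\<dots> \<le> card (?U - X) + card ?L" by (rule card_Un_le)
  finally have "real (card ?U) \<le> real (card (climb n X (Suc j))) + real (card ?L)" by simp
  then have "real (card ?U) / (n choose Suc j)
      \<le> (real (card (climb n X (Suc j))) + real (card ?L)) / (n choose Suc j)"
    by (rule divide_right_mono) simp
  moreover have "real (card (climb n X j)) / (n choose j) \<le> real (card ?U) / (n choose Suc j)"
    using Suc.prems by (intro density_up_shadow climb_layer) auto
  ultimately show ?case using Suc.IH Suc.prems unfolding s by (simp add: add_divide_distrib)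
qed

text \<open>
  The density bound holds with the same loss in every layer, and the layers partition the \<open>2\<^sup>n\<close>
  subsets.
\<close>

lemma card_Union_climb:
  assumes "finite X"
  shows "(1 - (\<Sum>x\<in>X. 1 / real (n choose card x))) * 2 ^ n
    \<le> real (card (\<Union>j\<le>n. climb n X j))"
proof -
  let ?d = "\<Sum>x\<in>X. 1 / real (n choose card x)"
  have "(1 - ?d) * real (n choose j) \<le> real (card (climb n X j))" if "j \<le> n" for j
  proof -
    have "(\<Sum>x\<in>{x \<in> X. card x \<le> j}. 1 / real (n choose card x)) \<le> ?d"
      using assms by (intro sum_mono2) auto
    with density_climb[OF assms that]
    have "1 - ?d \<le> real (card (climb n X j)) / (n choose j)" by linarith
    moreover have "real (n choose j) > 0" using that by (simp add: zero_less_binomial_iff)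
    ultimately show ?thesis by (simp add: pos_le_divide_eq)
  qed
  then have "(\<Sum>j\<le>n. (1 - ?d) * real (n choose j)) \<le> (\<Sum>j\<le>n. real (card (climb n X j)))"
    by (intro sum_mono) auto
  moreover have "card (\<Union>j\<le>n. climb n X j) = (\<Sum>j\<le>n. card (climb n X j))"
  proof (rule card_UN_disjoint)
    show "\<forall>i\<in>{..n}. finite (climb n X i)"
      using finite_subset[OF climb_layer finite_layer] by auto
    show "\<forall>i\<in>{..n}. \<forall>j\<in>{..n}. i \<noteq> j \<longrightarrow> climb n X i \<inter> climb n X j = {}"
      using climb_layer by blast
  qed auto
  moreover have "(\<Sum>j\<le>n. (1 - ?d) * real (n choose j)) = (1 - ?d) * 2 ^ n"
    using choose_row_sum[of n, THEN arg_cong, where f = real] by (simp add: sum_distrib_left[symmetric])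
  ultimately show ?thesis by simp
qed

section \<open>Coordinates of the hypercube relative to a vertex\<close>

text \<open>
  Seen from a vertex \<open>v\<close>, the cube is the Boolean lattice: \<open>w\<close> corresponds to the set of
  coordinates in which it differs from \<open>v\<close>, whose size is the Hamming distance. Geodesics
  starting at \<open>v\<close> become chains that start at the empty set.
\<close>

definition diff_set :: "bool list \<Rightarrow> bool list \<Rightarrow> nat set" where
  "diff_set v w = {i. i < length v \<and> v ! i \<noteq> w ! i}"

lemma diff_set_self: "diff_set v v = {}"
  by (simp add: diff_set_def)

lemma diff_set_commute: "length v = length w \<Longrightarrow> diff_set v w = diff_set w v"
  by (auto simp: diff_set_def)

lemma finite_diffs [simp]: "finite (diff_set v w)"
  by (simp add: diff_set_def)

lemma diff_set_subset: "length v = n \<Longrightarrow> diff_set v w \<subseteq> {..<n}"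
  by (auto simp: diff_set_def)

lemma card_diffs_le: "length v = n \<Longrightarrow> card (diff_set v w) \<le> n"
  using card_mono[OF _ diff_set_subset, of n v w] by simp

lemma diff_set_inject:
  assumes "length v = n" "length a = n" "length b = n" "diff_set v a = diff_set v b"
  shows "a = b"
proof (rule nth_equalityI)
  fix i assume "i < length a"
  then have "(v ! i \<noteq> a ! i) = (v ! i \<noteq> b ! i)"
    using assms by (auto simp: diff_set_def set_eq_iff)
  then show "a ! i = b ! i" by auto
qed (use assms in simp)

lemma diff_set_surj:
  assumes "length v = n" "S \<subseteq> {..<n}"
  obtains w where "length w = n" "diff_set v w = S"
proof
  show "diff_set v (map (\<lambda>i. v ! i \<noteq> (i \<in> S)) [0..<n]) = S"
    using assms by (auto simp: diff_set_def)
qed simp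

lemma card_sphere:
  assumes v: "length v = n"
  shows "card {w. length w = n \<and> card (diff_set v w) = j} = n choose j"
proof -
  have "bij_betw (diff_set v) {w. length w = n \<and> card (diff_set v w) = j} {S. S \<subseteq> {..<n} \<and> card S = j}"
    unfolding bij_betw_def
  proof
    show "inj_on (diff_set v) {w. length w = n \<and> card (diff_set v w) = j}"
      using diff_set_inject[OF v] by (intro inj_onI) blast
    show "diff_set v ` {w. length w = n \<and> card (diff_set v w) = j} = {S. S \<subseteq> {..<n} \<and> card S = j}"
      using diff_set_subset[OF v] by (auto simp: image_iff) (metis diff_set_surj[OF v])
  qed
  then show ?thesis using bij_betw_same_card by (fastforce simp: n_subsets)
qed

lemma card_hypercube_verts: "card {w :: bool list. length w = n} = 2 ^ n"
  using card_lists_length_eq[of "UNIV :: bool set" n] by simp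

lemma hypercube_arcI:
  assumes "length v = n" "length w = n" "length w' = n"
    and d: "diff_set v w' = insert i (diff_set v w)" "i < n" "i \<notin> diff_set v w"
  shows "(w, w') \<in> parcs (hypercube n)"
proof -
  have "w ! l \<noteq> w' ! l \<longleftrightarrow> l = i" if "l < n" for l
  proof -
    have "l \<in> diff_set v w' \<longleftrightarrow> l = i \<or> l \<in> diff_set v w" using d by auto
    moreover have "l \<in> diff_set v w' \<longleftrightarrow> v ! l \<noteq> w' ! l" "l \<in> diff_set v w \<longleftrightarrow> v ! l \<noteq> w ! l"
      using that assms(1) by (auto simp: diff_set_def)
    ultimately show ?thesis using d(3) by (cases "l = i") auto
  qed
  then show ?thesis using assms by (auto simp: hypercube_def)
qed

lemma card_diffs_arc:
  assumes "(x, y) \<in> parcs (hypercube n)" "length v = n"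
  shows "card (diff_set v y) \<le> Suc (card (diff_set v x))"
proof -
  obtain i where i: "i < n" "\<And>l. l < n \<Longrightarrow> x ! l \<noteq> y ! l \<Longrightarrow> l = i"
    using assms(1) by (auto simp: hypercube_def)
  have "diff_set v y \<subseteq> insert i (diff_set v x)"
  proof
    fix l assume "l \<in> diff_set v y"
    then have l: "l < n" "v ! l \<noteq> y ! l" using assms(2) by (auto simp: diff_set_def)
    show "l \<in> insert i (diff_set v x)"
    proof (cases "x ! l = y ! l")
      case True
      then show ?thesis using l assms(2) by (simp add: diff_set_def)
    next
      case False
      then show ?thesis using i(2) l(1) by blast
    qed
  qed
  then have "card (diff_set v y) \<le> card (insert i (diff_set v x))" by (intro card_mono) auto
  also have "\<dots> \<le> Suc (card (diff_set v x))" by (rule card_insert_le_m1) auto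
  finally show ?thesis .
qed

section \<open>The robber's reach\<close>

text \<open>
  A legal robber move uses a path without repeated vertices. It suffices to extend walks, since
  a walk can be shortened to a path on a subset of its vertices.
\<close>

lemma robber_move_step:
  assumes "robber_move G C u v" "(v, w) \<in> parcs G" "v \<notin> C" "w \<notin> C" "v \<in> pverts G" "w \<in> pverts G"
  shows "robber_move G C u w"
proof -
  have "\<exists>p. vwalk p (with_proj G) \<and> hd p = u \<and> last p = v \<and> set p \<inter> C = {}"
    using assms(1) unfolding robber_move_def
  proof
    assume "u = v"
    then show ?thesis using assms by (intro exI[of _ "[v]"]) (auto simp: vwalk_def)
  qed (auto simp: vpath_def)
  then obtain p where p: "vwalk p (with_proj G)" "hd p = u" "last p = v" "set p \<inter> C = {}"
    by auto
  have ne: "p \<noteq> []" using p(1) by auto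
  have "vwalk (p @ [w]) (with_proj G)"
    using p assms ne by (auto simp: vwalk_def vwalk_arcs_append arcs_ends_def arc_to_ends_def)
  then have "vpath (vwalk_to_vpath (p @ [w])) (with_proj G)"
    by (rule vwalk_to_vpath_vpath)
  moreover have "set (vwalk_to_vpath (p @ [w])) \<inter> C = {}"
    using p(4) assms(4) by (auto dest!: vwalk_to_vpath_subset)
  ultimately show ?thesis unfolding robber_move_def
    using p ne by (intro disjI2 exI[of _ "vwalk_to_vpath (p @ [w])"])
      (auto simp: vwalk_to_vpath_hd vwalk_to_vpath_last)
qed

lemma robber_move_climb:
  assumes v: "length v = n" and C: "C \<subseteq> {w. length w = n}"
    and "diff_set v w \<in> climb n (diff_set v ` C) j" "length w = n"
  shows "w \<notin> C \<and> robber_move (hypercube n) C v w"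
  using assms(3,4)
proof (induction j arbitrary: w)
  case 0
  then have "w \<notin> C" "diff_set v w = {}" by auto
  then have "w = v"
    using diff_set_inject[OF v _ v] 0 diff_set_self[of v] by simp
  with \<open>w \<notin> C\<close> show ?case by (simp add: robber_move_def)
next
  case (Suc j)
  then have "w \<notin> C" by auto
  from Suc.prems obtain i S where S: "diff_set v w = insert i S" "S \<in> climb n (diff_set v ` C) j"
      "i < n" "i \<notin> S"
    by (auto simp: up_shadow_def)
  then have "S \<subseteq> {..<n}" using climb_layer[of n "diff_set v ` C" j] by auto
  then obtain u where u: "length u = n" "diff_set v u = S"
      using diff_set_surj[OF v] by blast
  then have "u \<notin> C" "robber_move (hypercube n) C v u" using Suc.IH S by auto
  moreover have "(u, w) \<in> parcs (hypercube n)"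
    using u S Suc.prems v by (intro hypercube_arcI[of v n u w i]) auto
  ultimately have "robber_move (hypercube n) C v w"
    using \<open>w \<notin> C\<close> u Suc.prems by (intro robber_move_step[of _ C v u w]) (auto simp: hypercube_def)
  with \<open>w \<notin> C\<close> show ?case by simp
qed

text \<open>
  Carries the counting of \<open>climb\<close> over to the cube, with the cops' difference sets as obstacles. The
  subtracted sum is the expected number of cops on a random geodesic from \<open>v\<close> to its antipode.
\<close>

lemma card_reach:
  assumes v: "length v = n" and C: "C \<subseteq> {w. length w = n}"
  shows "(1 - (\<Sum>x\<in>C. 1 / real (n choose card (diff_set v x)))) * 2 ^ n
    \<le> card {w. length w = n \<and> robber_move (hypercube n) C v w}"
proof -
  let ?R = "{w. length w = n \<and> robber_move (hypercube n) C v w}"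
  have finC: "finite C"
    using C finite_hypercube_verts[of n] finite_subset by (auto simp: hypercube_def)
  have inj: "inj_on (diff_set v) {w. length w = n}"
    using diff_set_inject[OF v] by (intro inj_onI) blast
  have "(\<Union>j\<le>n. climb n (diff_set v ` C) j) \<subseteq> diff_set v ` ?R"
  proof
    fix S assume "S \<in> (\<Union>j\<le>n. climb n (diff_set v ` C) j)"
    then obtain j where j: "S \<in> climb n (diff_set v ` C) j" by auto
    then have "S \<subseteq> {..<n}" using climb_layer[of n "diff_set v ` C" j] by auto
    then obtain u where u: "length u = n" "diff_set v u = S"
      using diff_set_surj[OF v] by blast
    then show "S \<in> diff_set v ` ?R" using robber_move_climb[OF v C, of u j] j by auto
  qed
  moreover have finR: "finite ?R"
    using finite_hypercube_verts[of n] by (auto simp: hypercube_def)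
  ultimately have "card (\<Union>j\<le>n. climb n (diff_set v ` C) j) \<le> card ?R"
    by (meson card_image_le card_mono finite_imageI le_trans)
  moreover have "(\<Sum>x\<in>diff_set v ` C. 1 / real (n choose card x))
      = (\<Sum>x\<in>C. 1 / real (n choose card (diff_set v x)))"
    using inj_on_subset[OF inj C] by (simp add: sum.reindex)
  ultimately show ?thesis using card_Union_climb[of "diff_set v ` C" n] finC by simp
qed

section \<open>The threat posed by the cops\<close>

text \<open>
  The largest value of \<open>1 / (n choose i)\<close> with \<open>\<bar>i - j\<bar> \<le> 1\<close>: binomial coefficients decrease
  away from \<open>n / 2\<close>, so the extremal \<open>i\<close> is one step further from the middle than \<open>j\<close>, and \<open>0\<close> or
  \<open>n\<close> if \<open>j\<close> is already at the end (here truncated subtraction gives \<open>0 - 1 = 0\<close>). A cop at distance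
  \<open>j\<close> from \<open>v\<close> can step to distance \<open>i\<close>, where the random geodesic from \<open>v\<close> meets her with
  probability \<open>1 / (n choose i)\<close>.
\<close>

definition threat :: "nat \<Rightarrow> nat \<Rightarrow> real" where
  "threat n j = 1 / real (n choose (min j (n - j) - 1))"

lemma threat_nonneg: "threat n j \<ge> 0"
  by (simp add: threat_def)

lemma choose_min: "j \<le> n \<Longrightarrow> n choose (min j (n - j)) = n choose j"
  using binomial_symmetric[of j n] by (simp add: min_def)

lemma threat_ge:
  assumes "i \<le> n" "j \<le> n" "i \<le> Suc j" "j \<le> Suc i"
  shows "1 / real (n choose i) \<le> threat n j"
proof -
  have "n choose (min j (n - j) - 1) \<le> n choose (min i (n - i))"
    using assms by (intro binomial_mono) auto
  moreover have "n choose (min j (n - j) - 1) > 0"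
    by (simp add: zero_less_binomial_iff)
  ultimately show ?thesis
    using assms unfolding threat_def choose_min[OF assms(1)] by (intro divide_left_mono) auto
qed

lemma choose_ratio: "0 < j \<Longrightarrow> j \<le> n \<Longrightarrow> real (n choose j) / real (n choose (j - 1)) = (real n + 1) / j - 1"
proof -
  assume j: "0 < j" "j \<le> n"
  then obtain i where i: "j = Suc i" by (cases j) auto
  have "(n choose Suc i) * Suc i = (n choose i) * (n - i)"
    by (metis binomial_absorb_comp binomial_absorption mult.commute)
  then have "real (n choose Suc i) * real (Suc i) = real (n choose i) * real (n - i)"
    by (metis of_nat_mult)
  moreover have "real (n choose i) > 0" using j i by (simp add: zero_less_binomial_iff)
  ultimately show ?thesis using j i by (simp add: field_simps of_nat_diff)
qed

text \<open>
  Up to the middle layer the terms are \<open>(n choose j) / (n choose (j - 1)) = (n + 1) / j - 1\<close> (and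
  \<open>1\<close> for \<open>j = 0\<close>), which add up to a harmonic number; the upper half mirrors the lower one. The
  negative part \<open>- 1\<close> of each term is kept because it is needed to absorb the linear terms in the
  next lemma.
\<close>

lemma sum_threat_le:
  assumes "n \<ge> 2"
  shows "(\<Sum>j\<le>n. real (n choose j) * threat n j)
    \<le> 2 * (1 + (real n + 1) * (ln (real n / 2) + 1) - (real n - 1) / 2)"
proof -
  let ?m = "n div 2"
  define f where "f = (\<lambda>j. real (n choose j) / real (n choose (j - 1)))"
  have f: "real (n choose j) * threat n j = f (min j (n - j))" if "j \<le> n" for j
    using choose_min[OF that] by (simp add: f_def threat_def)
  have f0: "f j \<ge> 0" for j by (simp add: f_def)
  have "(\<Sum>j\<le>n. real (n choose j) * threat n j) = (\<Sum>j\<le>n. f (min j (n - j)))"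
    by (intro sum.cong) (auto simp: f)
  also have "\<dots> = (\<Sum>j\<in>{..?m} \<union> {?m<..n}. f (min j (n - j)))"
    by (rule sum.cong) auto
  also have "\<dots>
      = (\<Sum>j\<le>?m. f (min j (n - j))) + (\<Sum>j\<in>{?m<..n}. f (min j (n - j)))"
    by (rule sum.union_disjoint) auto
  also have "(\<Sum>j\<le>?m. f (min j (n - j))) = (\<Sum>j\<le>?m. f j)"
    by (intro sum.cong) (auto simp: min_def)
  also have "(\<Sum>j\<in>{?m<..n}. f (min j (n - j))) = (\<Sum>j\<in>{?m<..n}. f (n - j))"
    by (intro sum.cong) (auto simp: min_def)
  also have "\<dots> = (\<Sum>j\<in>(\<lambda>j. n - j) ` {?m<..n}. f j)"
    by (subst sum.reindex) (auto simp: inj_on_def)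
  also have "\<dots> \<le> (\<Sum>j\<le>?m. f j)"
    using f0 by (intro sum_mono2) auto
  also have "(\<Sum>j\<le>?m. f j) = 1 + (\<Sum>j=1..?m. f j)"
    by (simp add: atMost_atLeast0 sum.atLeast_Suc_atMost f_def)
  also have "(\<Sum>j=1..?m. f j) = (\<Sum>j=1..?m. (real n + 1) / real j - 1)"
    by (intro sum.cong) (auto simp: f_def choose_ratio[unfolded One_nat_def] divide_inverse[symmetric])
  also have "\<dots> = (real n + 1) * harm ?m - ?m"
    by (simp add: sum_subtractf harm_def sum_distrib_left divide_inverse)
  also have "\<dots> \<le> (real n + 1) * (ln (real n / 2) + 1) - (real n - 1) / 2"
  proof -
    have m: "?m > 0" using assms by auto
    have "harm ?m - ln (real ?m) \<le> harm 1 - ln (real 1)"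
      using m by (intro euler_mascheroni_sequence_decreasing) auto
    moreover have "ln (real ?m) \<le> ln (real n / 2)"
      using m by (subst ln_le_cancel_iff) (use assms in linarith)+
    ultimately have "harm ?m \<le> ln (real n / 2) + 1" by (simp add: harm_def)
    moreover have "(real n - 1) / 2 \<le> real ?m"
    proof -
      have "n \<le> 2 * ?m + 1" by linarith
      then have "real n \<le> 2 * real ?m + 1" by linarith
      then show ?thesis by simp
    qed
    ultimately show ?thesis by (intro diff_mono mult_left_mono) auto
  qed
  finally show ?thesis by (simp add: field_simps)
qed

text \<open>
  Besides the main term \<open>2 n ln n\<close>, the previous bound contains the linear term
  \<open>(2 (1 - ln 2) - 1) n\<close> and terms of order \<open>ln n\<close>. The linear term is negative since \<open>ln 2 > 1/2\<close>;
  the estimate \<open>ln 2 \<ge> 2/3\<close> is used to see this.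
\<close>

lemma eventually_sum_threat_le:
  "\<forall>\<^sub>F n in sequentially. (\<Sum>j\<le>n. real (n choose j) * threat n j) \<le> 2 * real n * ln (real n)"
proof -
  have *: "\<forall>\<^sub>F n in sequentially. 2 * (1 + (real n + 1) * (ln (real n) + 1 / 3) - (real n - 1) / 2)
      \<le> 2 * real n * ln (real n)"
    by real_asymp
  have "\<forall>\<^sub>F n in sequentially. 2 * (1 + (real n + 1) * (ln (real n / 2) + 1) - (real n - 1) / 2)
      \<le> 2 * real n * ln (real n)"
    using * eventually_gt_at_top[of 0]
  proof eventually_elim
    case (elim n)
    then have "ln (real n / 2) \<le> ln (real n) - 2 / 3"
      using ln2_ge_two_thirds by (simp add: ln_div)
    then have "(real n + 1) * (ln (real n / 2) + 1) \<le> (real n + 1) * (ln (real n) + 1 / 3)"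
      by (intro mult_left_mono) auto
    then have "2 * (1 + (real n + 1) * (ln (real n / 2) + 1) - (real n - 1) / 2)
        \<le> 2 * (1 + (real n + 1) * (ln (real n) + 1 / 3) - (real n - 1) / 2)"
      by (intro mult_left_mono diff_right_mono add_left_mono) auto
    also note elim(1)
    finally show ?case .
  qed
  with eventually_ge_at_top[of 2] show ?thesis
  proof eventually_elim
    case (elim n)
    then show ?case using sum_threat_le[of n] by linarith
  qed
qed

definition exposure :: "nat \<Rightarrow> (nat \<Rightarrow> bool list) \<Rightarrow> bool list \<Rightarrow> real" where
  "exposure k c v = (\<Sum>i<k. threat (length v) (card (diff_set v (c i))))"

text \<open>
  Summing over all vertices first, every cop sees \<open>n choose j\<close> vertices at distance \<open>j\<close>, wherever
  she stands.
\<close>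

lemma sum_exposure:
  assumes "\<And>i. i < k \<Longrightarrow> length (c i) = n"
  shows "(\<Sum>v | length v = n. exposure k c v) = k * (\<Sum>j\<le>n. real (n choose j) * threat n j)"
proof -
  have fin: "finite {v :: bool list. length v = n}"
    using finite_hypercube_verts[of n] by (simp add: hypercube_def)
  have "(\<Sum>v | length v = n. threat n (card (diff_set v (c i))))
      = (\<Sum>j\<le>n. real (n choose j) * threat n j)" if "i < k" for i
  proof -
    have ci: "length (c i) = n" using assms that .
    have "(\<Sum>v | length v = n. threat n (card (diff_set v (c i))))
        = (\<Sum>v | length v = n. threat n (card (diff_set (c i) v)))"
      using ci by (intro sum.cong) (auto simp: diff_set_commute)
    also have "\<dots> = (\<Sum>j\<le>n. \<Sum>v | v \<in> {v. length v = n} \<and> card (diff_set (c i) v) = j.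
        threat n (card (diff_set (c i) v)))"
      using fin ci by (intro sum.group[symmetric]) (auto simp: card_diffs_le)
    also have "\<dots> = (\<Sum>j\<le>n. real (n choose j) * threat n j)"
      by (intro sum.cong) (simp_all add: card_sphere[OF ci])
    finally show ?thesis .
  qed
  moreover have "(\<Sum>v | length v = n. exposure k c v)
      = (\<Sum>i<k. \<Sum>v | length v = n. threat n (card (diff_set v (c i))))"
    by (subst sum.swap) (auto simp: exposure_def intro!: sum.cong)
  ultimately show ?thesis by simp
qed

definition safe :: "nat \<Rightarrow> nat \<Rightarrow> (nat \<Rightarrow> bool list) \<Rightarrow> bool list set" where
  "safe n k c = {v. length v = n \<and> exposure k c v < 1 / 2}"

text \<open>
  Markov's inequality: every unsafe vertex has exposure at least \<open>1/2\<close>.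
\<close>

lemma card_safe:
  assumes c: "\<And>i. i < k \<Longrightarrow> length (c i) = n"
    and k: "4 * k * (\<Sum>j\<le>n. real (n choose j) * threat n j) < 2 ^ n"
  shows "real (card (safe n k c)) > 2 ^ n / 2"
proof -
  let ?V = "{v :: bool list. length v = n}"
  let ?B = "?V - safe n k c"
  have fin: "finite ?V"
    using finite_hypercube_verts[of n] by (simp add: hypercube_def)
  have e0: "exposure k c v \<ge> 0" for v
    by (auto simp: exposure_def threat_nonneg intro!: sum_nonneg)
  have "real (card ?B) / 2 = (\<Sum>v\<in>?B. 1 / 2)" by simp
  also have "\<dots> \<le> (\<Sum>v\<in>?B. exposure k c v)"
    by (intro sum_mono) (auto simp: safe_def)
  also have "\<dots> \<le> (\<Sum>v\<in>?V. exposure k c v)"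
    using fin e0 by (intro sum_mono2) auto
  finally have "real (card ?B) < 2 ^ n / 2"
    using k sum_exposure[OF c] by simp
  moreover have "card ?B = 2 ^ n - card (safe n k c)"
    using fin by (subst card_Diff_subset) (auto simp: safe_def card_hypercube_verts)
  moreover have "card (safe n k c) \<le> 2 ^ n"
    using card_mono[OF fin, of "safe n k c"] by (auto simp: safe_def card_hypercube_verts)
  ultimately show ?thesis by (simp add: of_nat_diff)
qed

definition cop_step :: "nat \<Rightarrow> nat \<Rightarrow> (nat \<Rightarrow> bool list) \<Rightarrow> (nat \<Rightarrow> bool list) \<Rightarrow> bool" where
  "cop_step n k c c' \<longleftrightarrow> (\<forall>i<k. c' i = c i \<or> (c i, c' i) \<in> parcs (hypercube n))"

text \<open>
  One step changes the distance of a cop from \<open>v\<close> by at most one, so what she contributes to the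
  sum afterwards is bounded by her threat to \<open>v\<close> before.
\<close>

lemma sum_after_cop_step:
  assumes c: "\<And>i. i < k \<Longrightarrow> length (c i) = n" and step: "cop_step n k c c'" and v: "v \<in> safe n k c"
  shows "(\<Sum>x\<in>c' ` {..<k}. 1 / real (n choose card (diff_set v x))) < 1 / 2"
proof -
  have lv: "length v = n" using v by (simp add: safe_def)
  have "(\<Sum>x\<in>c' ` {..<k}. 1 / real (n choose card (diff_set v x)))
      \<le> (\<Sum>i<k. 1 / real (n choose card (diff_set v (c' i))))"
    using sum_image_le[of "{..<k}" "\<lambda>x. 1 / real (n choose card (diff_set v x))" c'] by (simp add: o_def)
  also have "\<dots> \<le> (\<Sum>i<k. threat n (card (diff_set v (c i))))"
  proof (rule sum_mono)
    fix i assume "i \<in> {..<k}"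
    then have i: "c' i = c i \<or> (c i, c' i) \<in> parcs (hypercube n)"
      using step by (simp add: cop_step_def)
    moreover have "(c' i, c i) \<in> parcs (hypercube n)" if "(c i, c' i) \<in> parcs (hypercube n)"
    proof -
      have "(x ! l \<noteq> y ! l) = (y ! l \<noteq> x ! l)" for x y :: "bool list" and l by blast
      then show ?thesis using that unfolding hypercube_def by simp
    qed
    ultimately have "card (diff_set v (c' i)) \<le> Suc (card (diff_set v (c i)))"
        "card (diff_set v (c i)) \<le> Suc (card (diff_set v (c' i)))"
      using card_diffs_arc[OF _ lv] by auto
    then show "1 / real (n choose card (diff_set v (c' i))) \<le> threat n (card (diff_set v (c i)))"
      using lv by (intro threat_ge) (simp_all add: card_diffs_le)
  qed
  also have "\<dots> < 1 / 2" using v lv by (simp add: safe_def exposure_def)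
  finally show ?thesis .
qed

text \<open>
  A cop on \<open>v\<close> itself would contribute \<open>1 / (n choose 0) = 1\<close> to a sum that is below \<open>1/2\<close>.
\<close>

lemma safe_not_captured:
  assumes c: "\<And>i. i < k \<Longrightarrow> length (c i) = n" and step: "cop_step n k c c'" and v: "v \<in> safe n k c"
  shows "v \<notin> c' ` {..<k}"
proof
  assume "v \<in> c' ` {..<k}"
  then have "1 / real (n choose card (diff_set v v)) \<le> (\<Sum>x\<in>c' ` {..<k}. 1 / real (n choose card (diff_set v x)))"
    by (intro member_le_sum) auto
  with sum_after_cop_step[OF assms] show False by (simp add: diff_set_self)
qed

text \<open>
  Both the part of the cube that the robber can reach and the set of vertices that are safe for the
  new position of the cops make up at least half of the cube, the latter strictly more.
\<close>

lemma escape: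
  assumes c: "\<And>i. i < k \<Longrightarrow> length (c i) = n" and c': "\<And>i. i < k \<Longrightarrow> length (c' i) = n"
    and step: "cop_step n k c c'" and v: "v \<in> safe n k c"
    and k: "4 * k * (\<Sum>j\<le>n. real (n choose j) * threat n j) < 2 ^ n"
  shows "\<exists>w \<in> safe n k c'. robber_move (hypercube n) (c' ` {..<k}) v w"
proof (rule ccontr)
  let ?V = "{v :: bool list. length v = n}"
  let ?R = "{w. length w = n \<and> robber_move (hypercube n) (c' ` {..<k}) v w}"
  assume "\<not> ?thesis"
  then have disj: "?R \<inter> safe n k c' = {}" by (auto simp: safe_def)
  have fin: "finite ?V"
    using finite_hypercube_verts[of n] by (simp add: hypercube_def)
  have sub: "?R \<subseteq> ?V" "safe n k c' \<subseteq> ?V" by (auto simp: safe_def)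
  have lv: "length v = n" using v by (simp add: safe_def)
  have "card ?R + card (safe n k c') = card (?R \<union> safe n k c')"
    using disj finite_subset[OF sub(1) fin] finite_subset[OF sub(2) fin]
    by (simp add: card_Un_disjoint)
  also have "\<dots> \<le> card ?V" using sub fin by (intro card_mono) auto
  finally have "card ?R + card (safe n k c') \<le> 2 ^ n" by (simp only: card_hypercube_verts)
  then have "real (card ?R) + real (card (safe n k c')) \<le> 2 ^ n"
    by (metis of_nat_add of_nat_le_iff of_nat_numeral of_nat_power)
  moreover have "real (card ?R) \<ge> (1 - 1 / 2) * 2 ^ n"
  proof -
    let ?d = "\<Sum>x\<in>c' ` {..<k}. 1 / real (n choose card (diff_set v x))"
    have "(1 - 1 / 2) * 2 ^ n \<le> (1 - ?d) * (2 :: real) ^ n"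
      using sum_after_cop_step[OF c step v] by (intro mult_right_mono) auto
    also have "\<dots> \<le> real (card ?R)" using c' by (intro card_reach lv) auto
    finally show ?thesis .
  qed
  moreover have "real (card (safe n k c')) > 2 ^ n / 2" using c' k by (rule card_safe)
  ultimately show False by simp
qed

section \<open>The robber evades few cops forever\<close>

lemma legal_cop_strategy_length:
  assumes "legal_cop_strategy (hypercube n) k s" "i < k"
  shows "length (s h i) = n"
proof (induction h rule: rev_induct)
  case Nil
  then show ?case using assms by (auto simp: legal_cop_strategy_def hypercube_def)
next
  case (snoc r h)
  have "s (h @ [r]) i = s h i \<or> (s h i, s (h @ [r]) i) \<in> parcs (hypercube n)"
    using assms by (auto simp: legal_cop_strategy_def)
  then show ?case using snoc by (auto simp: hypercube_def)
qed

text \<open>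
  The cops' strategy depends on the whole history, so the robber's play is built as a sequence of
  growing histories, each extending the previous one by an escape move.
\<close>

lemma few_cops_lose:
  assumes k: "4 * k * (\<Sum>j\<le>n. real (n choose j) * threat n j) < 2 ^ n"
  shows "\<not> cops_win (hypercube n) k"
proof
  assume "cops_win (hypercube n) k"
  then obtain s where s: "legal_cop_strategy (hypercube n) k s"
    and win: "\<And>r. legal_robber_play (hypercube n) k s r \<Longrightarrow> captured k s r"
    by (auto simp: cops_win_def)
  note len = legal_cop_strategy_length[OF s]
  have step: "cop_step n k (s h) (s (h @ [r]))" for h r
    using s by (simp add: cop_step_def legal_cop_strategy_def)
  let ?P = "\<lambda>t h. length h = Suc t \<and> last h \<in> safe n k (s (butlast h))"
  let ?Q = "\<lambda>t h h'. butlast h' = h \<and> robber_move (hypercube n) (s h ` {..<k}) (last h) (last h')"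
  \<comment> \<open>\<open>h\<close> lists the robber's positions up to and including time \<open>t\<close>. The cops stand on
    \<open>s (butlast h)\<close> when he takes the last of them, and on \<open>s h\<close> after their next turn.\<close>
  have "\<exists>H. \<forall>t. ?P t (H t) \<and> ?Q t (H t) (H (Suc t))"
  proof (rule dependent_nat_choice)
    have "real (card (safe n k (s []))) > 2 ^ n / 2" using len k by (rule card_safe)
    then have "real (card (safe n k (s []))) > 0" by (rule le_less_trans[rotated]) simp
    then have "safe n k (s []) \<noteq> {}" by auto
    then obtain v where "v \<in> safe n k (s [])" by auto
    then show "\<exists>h. ?P 0 h" by (intro exI[of _ "[v]"]) simp
  next
    fix h t assume h: "?P t h"
    then have "h = butlast h @ [last h]" by (metis append_butlast_last_id length_0_conv nat.simps(3))
    then have "cop_step n k (s (butlast h)) (s h)" by (metis step)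
    then obtain w where "w \<in> safe n k (s h)"
        "robber_move (hypercube n) (s h ` {..<k}) (last h) w"
      using escape[of k "s (butlast h)" n "s h" "last h"] len k h by blast
    then show "\<exists>h'. ?P (Suc t) h' \<and> ?Q t h h'"
      using h by (intro exI[of _ "h @ [w]"]) simp
  qed
  then obtain H where P: "\<And>t. ?P t (H t)" and Q: "\<And>t. ?Q t (H t) (H (Suc t))" by auto
  define r where "r t = last (H t)" for t
  have snoc: "H t = butlast (H t) @ [r t]" for t
    using P[of t] unfolding r_def by (metis append_butlast_last_id length_0_conv nat.simps(3))
  have H: "H t = map r [0..<Suc t]" for t
  proof (induction t)
    case 0
    have "butlast (H 0) = []" using P[of 0] by (metis butlast_snoc length_butlast diff_Suc_1 length_0_conv)
    with snoc[of 0] show ?case by simp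
  next
    case (Suc t)
    with snoc[of "Suc t"] Q[of t] show ?case by simp
  qed
  have safe: "r t \<in> safe n k (s (map r [0..<t]))" for t
    using P[of t] unfolding H by simp
  have "legal_robber_play (hypercube n) k s r"
    unfolding legal_robber_play_def
  proof
    show "r 0 \<in> pverts (hypercube n)" using safe[of 0] by (simp add: safe_def hypercube_def)
    show "\<forall>t. robber_move (hypercube n) (cops_at k s r (Suc t)) (r t) (r (Suc t))"
      using Q unfolding cops_at_def H[symmetric] r_def by blast
  qed
  then have "captured k s r" by (rule win)
  then obtain t where "r t \<in> cops_at k s r t \<or> r t \<in> cops_at k s r (Suc t)"
    by (auto simp: captured_def)
  \<comment> \<open>The robber does not run into a cop by his own move: the case in which all cops stay put.\<close>
  moreover have "r t \<notin> s (map r [0..<t]) ` {..<k}"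
    by (rule safe_not_captured[OF len _ safe]) (simp_all add: cop_step_def)
  moreover have "r t \<notin> s (map r [0..<t] @ [r t]) ` {..<k}"
    by (rule safe_not_captured[OF len step safe])
  ultimately show False by (simp add: cops_at_def)
qed

theorem theorem4p3:
  shows "\<forall>\<^sub>F n :: nat in sequentially.
    real (cop_number_inf (hypercube n)) \<ge> 2 powr (real n - 3) / (real n * ln (real n))"
  using eventually_sum_threat_le eventually_ge_at_top[of 2]
proof eventually_elim
  case (elim n)
  let ?k = "cop_number_inf (hypercube n)"
  let ?S = "\<Sum>j\<le>n. real (n choose j) * threat n j"
  have pos: "real n * ln (real n) > 0" using elim(2) by simp
  have "\<not> 4 * ?k * ?S < 2 ^ n"
    using few_cops_lose[of ?k n] cops_win_cop_number_inf[OF finite_hypercube_verts, of n] by auto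
  then have "2 ^ n \<le> 4 * real ?k * ?S" by simp
  also have "\<dots> \<le> 4 * real ?k * (2 * real n * ln (real n))"
    using elim(1) by (intro mult_left_mono) auto
  finally have "2 ^ n / 8 \<le> real ?k * (real n * ln (real n))" by simp
  moreover have "2 powr (real n - 3) = 2 ^ n / 8"
    by (simp add: powr_diff powr_realpow)
  ultimately show ?case using pos by (simp add: pos_divide_le_eq)
qed

end
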